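(* Let $k\ge1$ and work in $k$-dimensional PGA $\mathbb{R}_{k,0,1}$. Let $C=\mathcal K_k$ be a $k$-simplicial complex in $\mathbb R^k$ with uniform mass distribution, described by its oriented boundary $\partial\mathcal K_k$ consisting of $(k-1)$-simplices $[v_0,\dots,v_{k-1}]$ (vertices given as normalized points), and let $\lVert C\rVert$ denote its $k$-volume. Then its center of mass $C_{\mathrm{com}}$, i.e. $\frac{1}{\lVert C\rVert}\int_C \vec x\,dV$ (the volume average of the normalized point at $\vec x$), is given by \[ C_{\mathrm{com}}=\frac{1}{\lVert C\rVert\,(k+1)!}\sum_{[v_0,\dots,v_{k-1}]\in\partial\mathcal K_k}\big(v_0+\cdots+v_{k-1}+o\big)\,\big(v_0\vee\cdots\vee v_{k-1}\vee o\big). \]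
   Context: $\mathbb{R}_{k,0,1}$ is the Clifford algebra generated by an orthogonal basis $\mathbf e_0,\mathbf e_1,\dots,\mathbf e_k$ with $\mathbf e_i^2=1$ for $i\ge1$ and $\mathbf e_0^2=0$; $\wedge$ is the outer product and the pseudoscalar is $\mathbf e_{01\cdots k}$. The Hodge dual is the linear map with $\mathbf e_J\mathbf e_J^*=\mathbf e_{01\cdots k}$ for every basis blade $\mathbf e_J$; the join is $(A\vee B)^*=A^*\wedge B^*$. The normalized point at $\vec x=\sum_{i=1}^k x_i\mathbf e_i$ is $(\mathbf e_0+\vec x)^*$, and $o=\mathbf e_0^*$ is the point at the origin. The join of $k$ boundary vertices with $o$ is a scalar (a signed $k$-volume times $k!$). The oriented boundary of a simplex is $\partial[v_0,\dots,v_k]=\sum_i(-1)^i[v_0,\dots,\widehat{v_i},\dots,v_k]$, extended linearly to complexes.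
   Formalization: The simplices of the complex are assumed oriented so that (-1)^k times the join of their k+1 vertices is positive; the formula holds for exactly this orientation, while e.g. for k=1 and the simplex [0,1] in standard order it gives minus the center of mass. *)

theory Defs
  imports "HOL-Analysis.Analysis"
begin

text \<open>Basis vectors are indexed by 'n option: None is e_0, Some i is e_i.
  The index order is e_0 < e_1 < ... < e_k (None below every Some i, Some i ordered
  by the linear order of 'n).  A multivector is its coefficient function on blades,
  a blade e_J being given by the set J of indices (product in increasing order).\<close>

type_synonym 'n mv = "'n option set \<Rightarrow> real"

fun idx_less :: "'n::linorder option \<Rightarrow> 'n option \<Rightarrow> bool" where
  "idx_less None None = False"
| "idx_less None (Some _) = True"
| "idx_less (Some _) None = False"
| "idx_less (Some i) (Some j) = (i < j)"

text \<open>Sign of reordering e_I e_J (I, J disjoint) into e_{I \<union> J}.\<close>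
definition blade_sign :: "'n::{finite,linorder} option set \<Rightarrow> 'n option set \<Rightarrow> real" where
  "blade_sign I J = (-1) ^ card {(i, j). i \<in> I \<and> j \<in> J \<and> idx_less j i}"

definition mv_zero :: "'n mv" where "mv_zero = (\<lambda>J. 0)"
definition mv_add :: "'n mv \<Rightarrow> 'n mv \<Rightarrow> 'n mv" where "mv_add A B = (\<lambda>J. A J + B J)"
definition mv_scale :: "real \<Rightarrow> 'n mv \<Rightarrow> 'n mv" where "mv_scale c A = (\<lambda>J. c * A J)"
definition mv_sum_list :: "'n mv list \<Rightarrow> 'n mv" where
  "mv_sum_list As = foldr mv_add As mv_zero"

definition scalar_part :: "'n mv \<Rightarrow> real" where "scalar_part A = A {}"

text \<open>Outer product: e_I \<and> e_J = 0 if I, J meet, otherwise blade_sign I J * e_{I \<union> J}.\<close>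
definition outer :: "'n::{finite,linorder} mv \<Rightarrow> 'n mv \<Rightarrow> 'n mv" where
  "outer A B = (\<lambda>K. \<Sum>I\<in>Pow K. blade_sign I (K - I) * A I * B (K - I))"

text \<open>Hodge dual: the linear map with e_J e_J^* = e_{01...k}; since J and its
  complement are disjoint, e_J e_{-J} = blade_sign J (-J) e_{01..k}, so
  e_J^* = blade_sign J (-J) e_{-J}.\<close>
definition hodge :: "'n::{finite,linorder} mv \<Rightarrow> 'n mv" where
  "hodge A = (\<lambda>K. blade_sign (- K) K * A (- K))"

definition unhodge :: "'n::{finite,linorder} mv \<Rightarrow> 'n mv" where
  "unhodge B = (\<lambda>J. blade_sign J (- J) * B (- J))"

definition join :: "'n::{finite,linorder} mv \<Rightarrow> 'n mv \<Rightarrow> 'n mv" where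
  "join A B = unhodge (outer (hodge A) (hodge B))"

fun join_list :: "'n::{finite,linorder} mv list \<Rightarrow> 'n mv" where
  "join_list [] = (\<lambda>J. if J = {} then 1 else 0)"
| "join_list (v # vs) = foldl join v vs"

definition e0_plus :: "real^'n \<Rightarrow> 'n mv" where
  "e0_plus x = (\<lambda>J. if J = {None} then 1
                   else if (\<exists>i. J = {Some i}) then x $ (THE i. J = {Some i}) else 0)"

definition point :: "real^'n::{finite,linorder} \<Rightarrow> 'n mv" where
  "point x = hodge (e0_plus x)"

definition origin_pt :: "'n::{finite,linorder} mv" where
  "origin_pt = point 0"

definition top_simplex :: "(real^'n) list \<Rightarrow> bool" where
  "top_simplex \<sigma> \<longleftrightarrow> length \<sigma> = CARD('n) + 1 \<and> distinct \<sigma> \<and> \<not> affine_dependent (set \<sigma>)"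

text \<open>A k-simplicial complex in R^k, given by its (distinct) top-dimensional simplices,
  any two of which meet in their common face.\<close>
definition simplicial_complex :: "(real^'n) list list \<Rightarrow> bool" where
  "simplicial_complex K \<longleftrightarrow>
     (\<forall>\<sigma>\<in>set K. top_simplex \<sigma>) \<and>
     (\<forall>i<length K. \<forall>j<length K. i \<noteq> j \<longrightarrow>
        set (K ! i) \<noteq> set (K ! j) \<and>
        convex hull (set (K ! i)) \<inter> convex hull (set (K ! j))
          = convex hull (set (K ! i) \<inter> set (K ! j)))"

definition carrier :: "(real^'n) list list \<Rightarrow> (real^'n) set" where
  "carrier K = (\<Union>\<sigma>\<in>set K. convex hull (set \<sigma>))"

definition face :: "nat \<Rightarrow> 'a list \<Rightarrow> 'a list" where
  "face i \<sigma> = take i \<sigma> @ drop (Suc i) \<sigma>"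

text \<open>Sum of an oriented-simplex function F over the oriented boundary chain
  \<partial>K = \<Sum>_{\<sigma>\<in>K} \<Sum>_i (-1)^i [face i \<sigma>] (extended linearly).\<close>
definition boundary_sum :: "((real^'n) list \<Rightarrow> 'n mv) \<Rightarrow> (real^'n) list list \<Rightarrow> 'n mv" where
  "boundary_sum F K = mv_sum_list
     (map (\<lambda>\<sigma>. mv_sum_list (map (\<lambda>i. mv_scale ((-1) ^ i) (F (face i \<sigma>))) [0..<length \<sigma>])) K)"

definition center_of_mass :: "(real^'n::{finite,linorder}) set \<Rightarrow> 'n mv" where
  "center_of_mass C = (\<lambda>J. (1 / measure lebesgue C) * integral C (\<lambda>x. point x J))"

end

theory Submission
  imports Defs "HOL-Library.Option_ord"
begin

text \<open>Applying the Hodge dual turns the join of points into the outer product of the vectors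
  \<open>e_0 + x\<close>, up to a common sign, so the scalar part \<open>D\<close> of the join of all vertices of a k-simplex is
  k! times its signed volume.  If \<open>a_i\<close> are the barycentric coordinates of the origin, Cramer's rule says
  that replacing the i-th vertex by the origin multiplies \<open>D\<close> by \<open>a_i\<close>.  The boundary sum over one simplex
  is therefore, up to the orientation sign, \<open>D\<close> times \<open>\<Sum>i. a_i (S - v_i + o)\<close>, which equals the sum \<open>S\<close>
  of the vertices.  The integral of the normalized point over the simplex is its volume times \<open>S / (k + 1)\<close>, because
  affine reflections exchanging two vertices preserve the simplex.  Distinct simplices of a complex
  overlap in null sets, so the contributions add up.\<close>

section \<open>Outer products of vectors\<close>

text \<open>The coefficient at \<open>e_K\<close> of the outer product of a list of vectors, by Laplace expansion along
  the last factor.  The factors are listed from last to first.\<close>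

primrec wedge :: "('a::linorder \<Rightarrow> real) list \<Rightarrow> 'a set \<Rightarrow> real" where
  "wedge [] = (\<lambda>K. of_bool (K = {}))"
| "wedge (v # vs) = (\<lambda>K. \<Sum>j\<in>K. (-1) ^ card {i\<in>K. j < i} * v j * wedge vs (K - {j}))"

lemma wedge_add:
  "wedge (xs @ (\<lambda>j. a j + b j) # ys) K = wedge (xs @ a # ys) K + wedge (xs @ b # ys) K"
  by (induction xs arbitrary: K) (simp_all add: algebra_simps sum.distrib)

lemma wedge_scale:
  "wedge (xs @ (\<lambda>j. c * a j) # ys) K = c * wedge (xs @ a # ys) K"
  by (induction xs arbitrary: K) (simp_all add: algebra_simps sum_distrib_left)

lemma wedge_zero: "wedge (xs @ (\<lambda>j. 0) # ys) K = 0"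
  using wedge_scale[of xs 0 "\<lambda>j. 0"] by simp

lemma wedge_scale_map:
  "wedge (map (\<lambda>i j. c i * f i j) is) K = prod_list (map c is) * wedge (map f is) K"
proof (induction "is" arbitrary: K)
  case (Cons i "is")
  then show ?case by (simp add: sum_distrib_left mult_ac)
qed simp

lemma wedge_sum_Cons:
  "wedge ((\<lambda>j. \<Sum>l\<in>L. c l * u l j) # ys) K = (\<Sum>l\<in>L. c l * wedge (u l # ys) K)"
  by (simp add: sum_distrib_left sum_distrib_right mult_ac) (rule sum.swap)

lemma wedge_map_cong:
  assumes "\<And>i j. i \<in> set is \<Longrightarrow> j \<in> K \<Longrightarrow> f i j = g i j"
  shows "wedge (map f is) K = wedge (map g is) K"
  using assms
proof (induction "is" arbitrary: K)
  case (Cons i "is")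
  have "wedge (map f is) (K - {j}) = wedge (map g is) (K - {j})" for j
    by (rule Cons.IH) (use Cons.prems in auto)
  then show ?case using Cons.prems by simp
qed simp

text \<open>Only the pair \<open>j < l\<close> itself tells the two orders of removal apart:
  \<open>l\<close> counts as greater than \<open>j\<close> unless it is removed first, while
  \<open>j\<close> is never greater than \<open>l\<close>. The extra one is the sign of a
  transposition.\<close>

lemma card_greater_swap:
  fixes j l :: "'a::linorder"
  assumes "finite K" "j \<in> K" "l \<in> K" "j < l"
  shows "card {i\<in>K. j < i} + card {i\<in>K - {j}. l < i}
    = Suc (card {i\<in>K. l < i} + card {i\<in>K - {l}. j < i})"
proof -
  have "{i\<in>K. j < i} = insert l {i\<in>K - {l}. j < i}" "{i\<in>K - {j}. l < i} = {i\<in>K. l < i}"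
    using assms by auto
  then show ?thesis using assms(1) by simp
qed

text \<open>Expanding along both copies of \<open>a\<close> gives a sum over ordered pairs of
  distinct indices; the terms for \<open>(j, l)\<close> and \<open>(l, j)\<close> cancel.\<close>

lemma wedge_Cons_Cons_same: "wedge (a # a # ys) K = 0"
proof (cases "finite K")
  case True
  \<comment> \<open>The value zero on the diagonal lets both indices range over all of
    \<open>K\<close>, so that \<open>sum.swap\<close> applies.\<close>
  define g where "g j l = (if j = l then 0 else
     (-1) ^ (card {i\<in>K. j < i} + card {i\<in>K - {j}. l < i}) * a j * a l * wedge ys (K - {j} - {l}))" for j l
  have anti: "g l j = - g j l" if "j \<in> K" "l \<in> K" for j l
  proof -
    have "K - {l} - {j} = K - {j} - {l}" by auto
    then show ?thesis
      using card_greater_swap[OF True that] card_greater_swap[OF True that(2,1)]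
      by (cases j l rule: linorder_cases) (simp_all add: g_def)
  qed
  have "wedge (a # a # ys) K = (\<Sum>j\<in>K. \<Sum>l\<in>K. g j l)"
  proof (simp only: wedge.simps, rule sum.cong)
    fix j assume j: "j \<in> K"
    have "(\<Sum>l\<in>K. g j l) = (\<Sum>l\<in>K - {j}. g j l)"
      using True by (intro sum.mono_neutral_right) (auto simp: g_def)
    also have "\<dots> = (-1) ^ card {i\<in>K. j < i} * a j * (\<Sum>l\<in>K - {j}.
        (-1) ^ card {i\<in>K - {j}. l < i} * a l * wedge ys (K - {j} - {l}))"
      unfolding sum_distrib_left by (rule sum.cong) (auto simp: g_def power_add)
    finally show "(-1) ^ card {i\<in>K. j < i} * a j * (\<Sum>l\<in>K - {j}.
        (-1) ^ card {i\<in>K - {j}. l < i} * a l * wedge ys (K - {j} - {l})) = (\<Sum>l\<in>K. g j l)" ..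
  qed simp
  moreover have "(\<Sum>j\<in>K. \<Sum>l\<in>K. g j l) = (\<Sum>j\<in>K. \<Sum>l\<in>K. g l j)"
    by (rule sum.swap)
  moreover have "\<dots> = - (\<Sum>j\<in>K. \<Sum>l\<in>K. g j l)"
    unfolding sum_negf[symmetric] by (intro sum.cong refl anti)
  ultimately show ?thesis by linarith
qed simp

lemma wedge_adjacent_same: "wedge (xs @ a # a # ys) K = 0"
proof (induction xs arbitrary: K)
  case Nil
  then show ?case using wedge_Cons_Cons_same by simp
qed simp

text \<open>Polarization: put \<open>a + b\<close> into both slots of an alternating form and expand
  by additivity; the terms with equal neighbours vanish.\<close>

lemma wedge_swap: "wedge (xs @ a # b # ys) K = - wedge (xs @ b # a # ys) K"
proof -
  let ?ab = "\<lambda>j. a j + b j"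
  have "0 = wedge (xs @ ?ab # ?ab # ys) K" by (simp only: wedge_adjacent_same)
  also have "\<dots> = wedge (xs @ a # ?ab # ys) K + wedge (xs @ b # ?ab # ys) K" by (rule wedge_add)
  also have "wedge (xs @ a # ?ab # ys) K = wedge (xs @ a # b # ys) K"
    using wedge_add[of "xs @ [a]" a b ys K] by (simp add: wedge_adjacent_same)
  also have "wedge (xs @ b # ?ab # ys) K = wedge (xs @ b # a # ys) K"
    using wedge_add[of "xs @ [b]" a b ys K] by (simp add: wedge_adjacent_same)
  finally show ?thesis by simp
qed

lemma wedge_move:
  "wedge (xs @ a # ys @ zs) K = (-1) ^ length ys * wedge (xs @ ys @ a # zs) K"
proof (induction ys arbitrary: xs)
  case (Cons y ys)
  show ?case
    using wedge_swap[of xs a y "ys @ zs" K] Cons[of "xs @ [y]"] by simp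
qed simp

lemma wedge_repeat: "wedge (xs @ a # ys @ a # zs) K = 0"
  using wedge_move[of xs a ys "a # zs" K] wedge_adjacent_same[of "xs @ ys" a zs K] by simp

lemma wedge_Cons_mem: "a \<in> set ys \<Longrightarrow> wedge (a # ys) K = 0"
  using wedge_repeat[of "[]"] by (auto dest!: split_list)

lemma wedge_add_multiple:
  assumes "b \<in> set xs \<union> set ys"
  shows "wedge (xs @ (\<lambda>j. a j + c * b j) # ys) K = wedge (xs @ a # ys) K"
proof -
  have "wedge (xs @ b # ys) K = 0"
    using assms
  proof
    assume "b \<in> set xs"
    then obtain us vs where "xs = us @ b # vs" by (auto dest!: split_list)
    then show ?thesis by (simp add: wedge_repeat)
  next
    assume "b \<in> set ys"
    then obtain us vs where "ys = us @ b # vs" by (auto dest!: split_list)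
    then show ?thesis by (simp add: wedge_repeat)
  qed
  then show ?thesis
    by (simp add: wedge_add[of _ a "\<lambda>j. c * b j"] wedge_scale)
qed

text \<open>Row operations against the last entry turn position vectors into edge vectors; for
  normalized points these have no \<open>e_0\<close> part.\<close>

lemma wedge_diff_last:
  "wedge (xs @ map (\<lambda>v j. v j - a j) ys @ [a]) K = wedge (xs @ ys @ [a]) K"
proof (induction ys arbitrary: xs)
  case (Cons y ys)
  show ?case
    using wedge_add_multiple[of a xs "map (\<lambda>v j. v j - a j) ys @ [a]" y "-1" K] Cons[of "xs @ [y]"]
    by simp
qed simp

text \<open>Only \<open>a\<close> has a component along \<open>b\<close>, so every nonzero term of
  the expansion saves \<open>b\<close> for \<open>a\<close>. As \<open>b\<close> lies below all
  other indices, it never enters the sign counts.\<close>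

lemma wedge_insert_least:
  assumes "finite K" "card K = length ys" "\<And>i. i \<in> K \<Longrightarrow> b < i" "\<And>y. y \<in> set ys \<Longrightarrow> y b = 0"
  shows "wedge (ys @ [a]) (insert b K) = a b * wedge ys K"
  using assms
proof (induction ys arbitrary: K)
  case Nil
  have *: "{i. i = b \<and> b < i} = {}" by auto
  show ?case using Nil by (simp add: card_eq_0_iff *)
next
  case (Cons y ys)
  have b: "b \<notin> K" using Cons.prems(3) by blast
  have "(-1) ^ card {i \<in> insert b K. j < i} * y j * wedge (ys @ [a]) (insert b K - {j})
     = a b * ((-1) ^ card {i \<in> K. j < i} * y j * wedge ys (K - {j}))" if j: "j \<in> K" for j
  proof -
    have "b < j" using Cons.prems(3) j .
    then have "{i \<in> insert b K. j < i} = {i \<in> K. j < i}" "insert b K - {j} = insert b (K - {j})"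
      by auto
    then show ?thesis
      using Cons.IH[of "K - {j}"] Cons.prems j by simp
  qed
  then have "(\<Sum>j\<in>K. (-1) ^ card {i \<in> insert b K. j < i} * y j * wedge (ys @ [a]) (insert b K - {j}))
     = a b * wedge (y # ys) K"
    by (simp only: wedge.simps sum_distrib_left cong: sum.cong)
  then show ?case
    using Cons.prems b by simp
qed

section \<open>Comparison with the determinant of a square matrix\<close>

lemma abs_wedge_units:
  assumes "distinct es" "bij_betw p K (set es)" "finite K"
  shows "\<bar>wedge (map (\<lambda>i a. of_bool (p a = i)) es) K\<bar> = 1"
  using assms
proof (induction es arbitrary: K)
  case Nil
  then show ?case by (simp add: bij_betw_def)
next
  case (Cons e es)
  then have "e \<in> p ` K" by (simp add: bij_betw_def)
  then obtain k where k: "k \<in> K" "p k = e" by blast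
  have inj: "p j = e \<longleftrightarrow> j = k" if "j \<in> K" for j
    using Cons.prems(2) k that by (auto simp: bij_betw_def inj_on_def)
  have "wedge (map (\<lambda>i a. of_bool (p a = i)) (e # es)) K
     = (\<Sum>j\<in>K. if j = k then (-1) ^ card {i\<in>K. k < i} * wedge (map (\<lambda>i a. of_bool (p a = i)) es) (K - {k}) else 0)"
    by (auto intro!: sum.cong simp: inj)
  also have "\<dots> = (-1) ^ card {i\<in>K. k < i} * wedge (map (\<lambda>i a. of_bool (p a = i)) es) (K - {k})"
    using k Cons.prems by simp
  moreover have "bij_betw p (K - {k}) (set es)"
    using bij_betw_DiffI[OF Cons.prems(2), of "{k}" "{e}"] k Cons.prems(1)
    by (simp add: bij_betw_def)
  ultimately show ?case
    using Cons.IH[of "K - {k}"] Cons.prems by (simp add: abs_mult power_abs)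
qed

text \<open>Both sides react alike to row operations, and on diagonal matrices both are the product
  of the diagonal up to sign. Absolute values avoid relating the orders of \<open>es\<close> and
  \<open>K\<close> to the sign of a permutation.\<close>

lemma abs_wedge_eq_abs_det:
  fixes A :: "real^'m^'m" and K :: "'a::linorder set"
  assumes es: "distinct es" "set es = UNIV" and K: "finite K" and p: "bij_betw p K UNIV"
  shows "\<bar>wedge (map (\<lambda>i a. A $ i $ p a) es) K\<bar> = \<bar>det A\<bar>"
proof -
  \<comment> \<open>\<open>p\<close> stays quantified because the column swap in the induction
    replaces it by its composition with a transposition.\<close>
  have "\<forall>p. bij_betw p K UNIV \<longrightarrow> \<bar>wedge (map (\<lambda>i a. A $ i $ p a) es) K\<bar> = \<bar>det A\<bar>"
  proof (induction A rule: induct_matrix_row_operations)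
    case (1 A i)
    obtain xs ys where "es = xs @ i # ys" using es(2) by (metis UNIV_I split_list)
    moreover have "A $ i $ j = 0" for j using 1 by (simp add: row_def vec_eq_iff)
    ultimately show ?case
      using det_zero_row(1)[OF 1] by (simp add: wedge_zero)
  next
    case (2 A)
    show ?case
    proof (intro allI impI)
      fix p :: "'a \<Rightarrow> 'm" assume p: "bij_betw p K UNIV"
      have "A $ i $ p a = A $ i $ i * of_bool (p a = i)" for i a using 2 by auto
      then have "wedge (map (\<lambda>i a. A $ i $ p a) es) K
         = prod_list (map (\<lambda>i. A $ i $ i) es) * wedge (map (\<lambda>i a. of_bool (p a = i)) es) K"
        by (simp only: wedge_scale_map)
      moreover have "prod_list (map (\<lambda>i. A $ i $ i) es) = det A"
        using prod.distinct_set_conv_list[OF es(1), of "\<lambda>i. A $ i $ i"] es(2)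
        by (simp add: det_diagonal 2)
      ultimately show "\<bar>wedge (map (\<lambda>i a. A $ i $ p a) es) K\<bar> = \<bar>det A\<bar>"
        using abs_wedge_units[OF es(1), of p K] p K es(2) by (simp add: abs_mult)
    qed
  next
    case (3 A m n)
    let ?t = "Transposition.transpose m n"
    have t: "?t permutes UNIV" by (simp add: permutes_swap_id)
    then have "bij_betw (?t \<circ> p) K UNIV" if "bij_betw p K UNIV" for p
      using that bij_betw_trans permutes_imp_bij by blast
    moreover have "\<bar>det (\<chi> i j. A $ i $ ?t j)\<bar> = \<bar>det A\<bar>"
      using det_permute_columns[OF t, of A] by (simp add: abs_mult sign_def)
    ultimately show ?case using 3(1) by (force simp: o_def)
  next
    case (4 A m n c)
    let ?B = "\<chi> i. if i = m then row m A + c *\<^sub>R row n A else row i A"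
    obtain xs ys where e: "es = xs @ m # ys" using es(2) by (metis UNIV_I split_list)
    show ?case
    proof (intro allI impI)
      fix p :: "'a \<Rightarrow> 'm" assume p: "bij_betw p K UNIV"
      have "m \<notin> set xs" "m \<notin> set ys" using es(1) e by auto
      then have "wedge (map (\<lambda>i a. ?B $ i $ p a) es) K
        = wedge (map (\<lambda>i a. A $ i $ p a) xs @ (\<lambda>a. A $ m $ p a + c * A $ n $ p a) # map (\<lambda>i a. A $ i $ p a) ys) K"
        by (auto simp: e row_def intro!: arg_cong[where f="\<lambda>l. wedge l K"])
      also have "\<dots> = wedge (map (\<lambda>i a. A $ i $ p a) es) K"
        unfolding e map_append list.map
        using es(2) 4(2) e by (intro wedge_add_multiple) auto
      finally show "\<bar>wedge (map (\<lambda>i a. ?B $ i $ p a) es) K\<bar> = \<bar>det ?B\<bar>"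
        using 4(1) p det_row_operation[OF 4(2), of A c, unfolded scalar_mult_eq_scaleR]
        by simp
    qed
  qed
  then show ?thesis using p by blast
qed

section \<open>Joins of points\<close>

lemma idx_less_iff_less: "idx_less x y \<longleftrightarrow> x < y"
  by (cases x; cases y) simp_all

lemma hodge_unhodge:
  fixes A :: "'n::{finite,linorder} mv"
  shows "hodge (unhodge A) = A"
proof
  fix K :: "'n option set"
  have "blade_sign (- K) K * blade_sign (- K) K = (1::real)"
    by (simp add: blade_sign_def flip: power_add mult_2)
  then show "hodge (unhodge A) K = A K"
    by (simp add: hodge_def unhodge_def flip: mult.assoc)
qed

text \<open>Each \<open>join\<close> ends in an \<open>unhodge\<close>, which the next dual cancels,
  so iterated joins become iterated outer products.\<close>

lemma hodge_foldl_join: "hodge (foldl join A vs) = foldl outer (hodge A) (map hodge vs)"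
  by (induction vs arbitrary: A) (simp_all add: join_def hodge_unhodge)

lemma scalar_part_eq_hodge_UNIV: "scalar_part A = hodge A UNIV"
  by (simp add: scalar_part_def hodge_def blade_sign_def)

definition grade1 :: "'n mv \<Rightarrow> bool" where
  "grade1 v \<longleftrightarrow> (\<forall>J. card J \<noteq> 1 \<longrightarrow> v J = 0)"

lemma blade_sign_singleton_right:
  "blade_sign (K - {j}) {j} = (-1) ^ card {i\<in>K. j < i}"
proof -
  have "{(i, l). i \<in> K - {j} \<and> l \<in> {j} \<and> idx_less l i} = (\<lambda>i. (i, j)) ` {i\<in>K. j < i}"
    by (auto simp: idx_less_iff_less)
  then show ?thesis
    by (simp add: blade_sign_def card_image inj_on_def)
qed

lemma blade_sign_singleton_left:
  "blade_sign {j} (K - {j}) = (-1) ^ card {i\<in>K. i < j}"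
proof -
  have "{(i, l). i \<in> {j} \<and> l \<in> K - {j} \<and> idx_less l i} = (\<lambda>i. (j, i)) ` {i\<in>K. i < j}"
    by (auto simp: idx_less_iff_less)
  then show ?thesis
    by (simp add: blade_sign_def card_image inj_on_def)
qed

text \<open>A blade of \<open>A\<close> contributes only if exactly one index of \<open>K\<close> is
  left for \<open>v\<close>. The result is the recursion step of \<open>wedge\<close>.\<close>

lemma outer_grade1:
  fixes A :: "'n::{finite,linorder} mv"
  assumes "grade1 v"
  shows "outer A v K = (\<Sum>j\<in>K. (-1) ^ card {i\<in>K. j < i} * v {j} * A (K - {j}))"
proof -
  have inj: "inj_on (\<lambda>j. K - {j}) K" by (auto simp: inj_on_def)
  have "outer A v K = (\<Sum>I\<in>(\<lambda>j. K - {j}) ` K. blade_sign I (K - I) * A I * v (K - I))"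
    unfolding outer_def
  proof (rule sum.mono_neutral_right)
    show "\<forall>I\<in>Pow K - (\<lambda>j. K - {j}) ` K. blade_sign I (K - I) * A I * v (K - I) = 0"
    proof
      fix I assume I: "I \<in> Pow K - (\<lambda>j. K - {j}) ` K"
      have "card (K - I) \<noteq> 1"
      proof
        assume "card (K - I) = 1"
        then obtain j where "K - I = {j}" by (auto simp: card_1_singleton_iff)
        then have "j \<in> K" "I = K - {j}" using I by auto
        then show False using I by auto
      qed
      then show "blade_sign I (K - I) * A I * v (K - I) = 0"
        using assms by (simp add: grade1_def)
    qed
  qed auto
  also have "\<dots> = (\<Sum>j\<in>K. (-1) ^ card {i\<in>K. j < i} * v {j} * A (K - {j}))"
    unfolding sum.reindex[OF inj] o_def
  proof (rule sum.cong)
    fix j assume "j \<in> K"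
    then have "K - (K - {j}) = {j}" by auto
    then show "blade_sign (K - {j}) (K - (K - {j})) * A (K - {j}) * v (K - (K - {j}))
       = (-1) ^ card {i\<in>K. j < i} * v {j} * A (K - {j})"
      by (simp add: blade_sign_singleton_right)
  qed simp
  finally show ?thesis .
qed

text \<open>\<open>outer\<close> appends a vector on the right, whereas \<open>wedge\<close> lists
  the last factor first; hence the reversal.\<close>

lemma foldl_outer_eq_wedge:
  fixes us :: "'n::{finite,linorder} mv list"
  assumes "\<And>u. u \<in> set us \<Longrightarrow> grade1 u"
  shows "foldl outer (wedge ws) us = wedge (rev (map (\<lambda>u j. u {j}) us) @ ws)"
  using assms
proof (induction us arbitrary: ws)
  case (Cons u us)
  have "outer (wedge ws) u = wedge ((\<lambda>j. u {j}) # ws)"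
    by (rule ext) (simp add: outer_grade1 Cons.prems)
  then show ?case using Cons by (simp del: wedge.simps)
qed simp

lemma grade1_eq_wedge:
  fixes v :: "'n::{finite,linorder} mv"
  assumes "grade1 v"
  shows "v = wedge [\<lambda>j. v {j}]"
proof
  fix K
  show "v K = wedge [\<lambda>j. v {j}] K"
  proof (cases "card K = 1")
    case True
    then obtain k where k: "K = {k}" by (auto simp: card_1_singleton_iff)
    have *: "{i. i = k \<and> k < i} = {}" by auto
    show ?thesis by (simp add: k *)
  next
    case False
    have "K - {j} \<noteq> {}" if "j \<in> K" for j
    proof
      assume "K - {j} = {}"
      then have "K = {j}" using that by auto
      then show False using False by simp
    qed
    then have "wedge [\<lambda>j. v {j}] K = 0"
      unfolding wedge.simps by (intro sum.neutral) simp
    then show ?thesis using False assms by (simp only: grade1_def) blast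
  qed
qed

text \<open>Affine dependence on \<open>x\<close> is what makes points commute with barycentric
  combinations and with averaging over a simplex.\<close>

lemma e0_plus_affine: "\<exists>c w. \<forall>x. e0_plus x J = c + w \<bullet> x"
proof (cases "\<exists>i. J = {Some i}")
  case True
  then obtain i where J: "J = {Some i}" by blast
  then have "e0_plus x J = 0 + axis i 1 \<bullet> x" for x
    by (simp add: e0_plus_def inner_axis')
  then show ?thesis by blast
next
  case False
  then have "e0_plus x J = (if J = {None} then 1 else 0) + 0 \<bullet> x" for x
    by (simp add: e0_plus_def)
  then show ?thesis by blast
qed

lemma hodge_affine:
  assumes "\<And>J. \<exists>c w. \<forall>x. f x J = c + w \<bullet> x"
  shows "\<exists>c w. \<forall>x. hodge (f x) J = c + w \<bullet> x"
proof -
  obtain c w where "\<And>x. f x (- J) = c + w \<bullet> x" using assms by metis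
  then have "hodge (f x) J = blade_sign (- J) J * c + (blade_sign (- J) J *\<^sub>R w) \<bullet> x" for x
    by (simp add: hodge_def algebra_simps)
  then show ?thesis by blast
qed

lemma point_affine: "\<exists>c w. \<forall>x. point x J = c + w \<bullet> x"
  unfolding point_def by (rule hodge_affine) (rule e0_plus_affine)

lemma hodge_point_affine: "\<exists>c w. \<forall>x. hodge (point x) J = c + w \<bullet> x"
  by (rule hodge_affine) (rule point_affine)

lemma affine_combination:
  assumes "\<exists>c w. \<forall>x. f x = c + w \<bullet> x" "sum a L = 1"
  shows "f (\<Sum>l\<in>L. a l *\<^sub>R u l) = (\<Sum>l\<in>L. a l * f (u l))"
proof -
  obtain c w where f: "\<And>x. f x = c + w \<bullet> x" using assms(1) by blast
  have "(\<Sum>l\<in>L. a l * f (u l)) = sum a L * c + (\<Sum>l\<in>L. a l * (w \<bullet> u l))"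
    by (simp add: f distrib_left sum.distrib sum_distrib_right)
  then show ?thesis using assms(2) by (simp add: f inner_sum_right)
qed

text \<open>The indices above \<open>j\<close> enter the sign of one dual and those below
  \<open>j\<close> the sign of the other. Together these are the k indices different from
  \<open>j\<close>, so the double dual multiplies every vector by the same sign.\<close>

lemma hodge_point:
  fixes x :: "real^'n::{finite,linorder}"
  shows "hodge (point x) {j} = (-1) ^ CARD('n) * e0_plus x {j}"
proof -
  have "UNIV = insert j ({i. i < j} \<union> {i. j < i})" by auto
  then have "card (UNIV :: 'n option set) = Suc (card ({i. i < j} \<union> {i. j < i}))"
    by (metis (no_types, lifting) card_insert_disjoint finite mem_Collect_eq Un_iff less_irrefl)
  also have "card ({i. i < j} \<union> {i. j < i}) = card {i. i < j} + card {i. j < i}"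
    by (intro card_Un_disjoint) auto
  finally have n: "card {i. j < i} + card {i. i < j} = CARD('n)" by (simp add: card_UNIV_option)
  have "blade_sign (- {j}) {j} * blade_sign {j} (- {j}) = (-1) ^ CARD('n)"
    using blade_sign_singleton_right[of UNIV j] blade_sign_singleton_left[of j UNIV]
    by (simp add: n Compl_eq_Diff_UNIV flip: power_add)
  then show ?thesis by (simp add: point_def hodge_def flip: mult.assoc)
qed

lemma grade1_hodge_point: "grade1 (hodge (point x))"
  unfolding grade1_def point_def hodge_def e0_plus_def by auto

text \<open>Homogeneous coordinates \<open>(1, x)\<close> of a point, times the sign
  \<open>(-1)^k\<close> of the double dual.\<close>

definition homogeneous :: "real^'n::{finite,linorder} \<Rightarrow> 'n option \<Rightarrow> real" where
  "homogeneous x j = hodge (point x) {j}"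

text \<open>Under the dual the scalar coefficient becomes the one at the full index set, and joins
  become outer products. The empty list is different: \<open>join_list []\<close> has scalar part 1,
  while \<open>wedge [] UNIV\<close> is 0.\<close>

lemma scalar_part_join_list:
  fixes vs :: "(real^'n::{finite,linorder}) list"
  assumes "vs \<noteq> []"
  shows "scalar_part (join_list (map point vs)) = wedge (rev (map homogeneous vs)) UNIV"
proof -
  obtain w ws where vs: "vs = w # ws" using assms by (cases vs) auto
  have "hodge (join_list (map point vs)) = foldl outer (hodge (point w)) (map hodge (map point ws))"
    by (simp add: vs hodge_foldl_join)
  also have "hodge (point w) = wedge [homogeneous w]"
    unfolding homogeneous_def by (rule grade1_eq_wedge[OF grade1_hodge_point])
  also have "foldl outer (wedge [homogeneous w]) (map hodge (map point ws))
     = wedge (rev (map (\<lambda>u j. u {j}) (map hodge (map point ws))) @ [homogeneous w])"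
    by (rule foldl_outer_eq_wedge) (auto simp: grade1_hodge_point)
  also have "rev (map (\<lambda>u j. u {j}) (map hodge (map point ws))) @ [homogeneous w] = rev (map homogeneous vs)"
    by (simp add: vs homogeneous_def fun_eq_iff)
  finally show ?thesis by (simp add: scalar_part_eq_hodge_UNIV)
qed

lemma rev_map_face:
  assumes "i < length \<sigma>"
  shows "rev (map f \<sigma>) = rev (map f (drop (Suc i) \<sigma>)) @ f (\<sigma> ! i) # rev (map f (take i \<sigma>))"
    "rev (map f (face i \<sigma> @ [x])) = f x # rev (map f (drop (Suc i) \<sigma>)) @ rev (map f (take i \<sigma>))"
proof -
  have "\<sigma> = take i \<sigma> @ \<sigma> ! i # drop (Suc i) \<sigma>" using assms by (simp add: id_take_nth_drop)
  then show "rev (map f \<sigma>) = rev (map f (drop (Suc i) \<sigma>)) @ f (\<sigma> ! i) # rev (map f (take i \<sigma>))"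
    by (metis (no_types, lifting) append_Cons append_Nil append_assoc list.simps(9) map_append rev.simps(2) rev_append)
  show "rev (map f (face i \<sigma> @ [x])) = f x # rev (map f (drop (Suc i) \<sigma>)) @ rev (map f (take i \<sigma>))"
    by (simp add: face_def)
qed

text \<open>Cramer's rule for the barycentric coordinates of the origin.\<close>

lemma scalar_part_join_list_face:
  fixes \<sigma> :: "(real^'n::{finite,linorder}) list"
  assumes i: "i < length \<sigma>"
    and a: "(\<Sum>l<length \<sigma>. a l) = 1" "(\<Sum>l<length \<sigma>. a l *\<^sub>R \<sigma> ! l) = 0"
  shows "scalar_part (join_list (map point (face i \<sigma>) @ [origin_pt]))
    = (-1) ^ (length \<sigma> - Suc i) * a i * scalar_part (join_list (map point \<sigma>))"
proof -
  let ?ys = "rev (map homogeneous (drop (Suc i) \<sigma>))" and ?zs = "rev (map homogeneous (take i \<sigma>))"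
  have homogeneous0: "homogeneous 0 = (\<lambda>j. \<Sum>l<length \<sigma>. a l * homogeneous (\<sigma> ! l) j)"
    using affine_combination[OF hodge_point_affine a(1), where u = "(!) \<sigma>"]
    by (simp add: a(2) homogeneous_def fun_eq_iff)
  \<comment> \<open>Every vertex other than the i-th still occurs among the remaining factors, so
    substituting it for the origin repeats a factor.\<close>
  have mem: "homogeneous (\<sigma> ! l) \<in> set (?ys @ ?zs)" if l: "l < length \<sigma>" "l \<noteq> i" for l
  proof (cases "l < i")
    case True
    then have "\<sigma> ! l = take i \<sigma> ! l" "l < length (take i \<sigma>)" using l by auto
    then show ?thesis by (metis Un_iff imageI nth_mem set_append set_map set_rev)
  next
    case False
    then have "\<sigma> ! l = drop (Suc i) \<sigma> ! (l - Suc i)" "l - Suc i < length (drop (Suc i) \<sigma>)"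
      using l by auto
    then show ?thesis by (metis Un_iff imageI nth_mem set_append set_map set_rev)
  qed
  have "scalar_part (join_list (map point (face i \<sigma>) @ [origin_pt]))
     = scalar_part (join_list (map point (face i \<sigma> @ [0])))"
    by (simp add: origin_pt_def)
  also have "\<dots> = wedge (homogeneous 0 # ?ys @ ?zs) UNIV"
    by (subst scalar_part_join_list) (simp_all only: rev_map_face[OF i], simp)
  also have "\<dots> = (\<Sum>l<length \<sigma>. a l * wedge (homogeneous (\<sigma> ! l) # ?ys @ ?zs) UNIV)"
    unfolding homogeneous0 by (rule wedge_sum_Cons)
  also have "\<dots> = (\<Sum>l<length \<sigma>. if l = i then a i * wedge (homogeneous (\<sigma> ! i) # ?ys @ ?zs) UNIV else 0)"
    by (rule sum.cong) (use wedge_Cons_mem[OF mem] in \<open>auto simp del: wedge.simps\<close>)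
  also have "\<dots> = a i * wedge (homogeneous (\<sigma> ! i) # ?ys @ ?zs) UNIV"
    using i by simp
  \<comment> \<open>Returning the i-th vertex to its place moves it past the later vertices,
    \<open>length \<sigma> - Suc i\<close> in number.\<close>
  also have "wedge (homogeneous (\<sigma> ! i) # ?ys @ ?zs) UNIV
     = (-1) ^ (length \<sigma> - Suc i) * wedge (?ys @ homogeneous (\<sigma> ! i) # ?zs) UNIV"
    using wedge_move[of "[]" "homogeneous (\<sigma> ! i)" ?ys ?zs UNIV] by simp
  also have "?ys @ homogeneous (\<sigma> ! i) # ?zs = rev (map homogeneous \<sigma>)"
    by (rule rev_map_face(1)[OF i, symmetric])
  also have "wedge (rev (map homogeneous \<sigma>)) UNIV = scalar_part (join_list (map point \<sigma>))"
    using i by (subst scalar_part_join_list) auto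
  finally show ?thesis by simp
qed

lemma mv_sum_list_apply: "mv_sum_list As J = (\<Sum>A\<leftarrow>As. A J)"
  by (induction As) (simp_all add: mv_sum_list_def mv_zero_def mv_add_def)

lemma sum_list_face:
  fixes f :: "'a \<Rightarrow> real"
  assumes "i < length \<sigma>"
  shows "(\<Sum>v\<leftarrow>face i \<sigma>. f v) = (\<Sum>v\<leftarrow>\<sigma>. f v) - f (\<sigma> ! i)"
  using arg_cong[OF id_take_nth_drop[OF assms], of "\<lambda>vs. \<Sum>v\<leftarrow>vs. f v"] by (simp add: face_def)

text \<open>The boundary sign \<open>(-1)^i\<close> and the Cramer sign \<open>(-1)^(k - i)\<close>
  combine to \<open>(-1)^k\<close> for every face. In the remaining sum of
  \<open>a_i (S + o - v_i)\<close>, the points \<open>a_i v_i\<close> add up to \<open>o\<close>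
  because points are affine in their position, and this cancels the added origin.\<close>

lemma boundary_moment:
  fixes \<sigma> :: "(real^'n::{finite,linorder}) list"
  assumes len: "length \<sigma> = CARD('n) + 1"
    and a: "(\<Sum>l<length \<sigma>. a l) = 1" "(\<Sum>l<length \<sigma>. a l *\<^sub>R \<sigma> ! l) = 0"
  shows "(\<Sum>i\<leftarrow>[0..<length \<sigma>]. (-1) ^ i *
      (scalar_part (join_list (map point (face i \<sigma>) @ [origin_pt]))
        * ((\<Sum>v\<leftarrow>face i \<sigma>. point v J) + origin_pt J)))
    = (-1) ^ CARD('n) * scalar_part (join_list (map point \<sigma>)) * (\<Sum>v\<leftarrow>\<sigma>. point v J)"
    (is "?L = ?s * ?D * ?S")
proof -
  have o: "origin_pt J = (\<Sum>l<length \<sigma>. a l * point (\<sigma> ! l) J)"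
    using affine_combination[OF point_affine a(1), where u = "(!) \<sigma>"] by (simp add: a(2) origin_pt_def)
  have "?L = (\<Sum>i<length \<sigma>. ?s * ?D * (a i * (?S + origin_pt J) - a i * point (\<sigma> ! i) J))"
    unfolding interv_sum_list_conv_sum_set_nat atLeast0LessThan set_upt
  proof (rule sum.cong)
    fix i assume "i \<in> {..<length \<sigma>}"
    then have i: "i < length \<sigma>" by simp
    then have s: "(-1) ^ i * (-1) ^ (length \<sigma> - Suc i) = (?s :: real)"
      using len by (simp flip: power_add)
    have "(-1) ^ i * ((-1) ^ (length \<sigma> - Suc i) * a i * ?D * (?S - point (\<sigma> ! i) J + origin_pt J))
      = (-1) ^ i * (-1) ^ (length \<sigma> - Suc i) * (a i * ?D * (?S - point (\<sigma> ! i) J + origin_pt J))"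
      by (simp only: mult.assoc)
    then show "(-1) ^ i * (scalar_part (join_list (map point (face i \<sigma>) @ [origin_pt]))
        * ((\<Sum>v\<leftarrow>face i \<sigma>. point v J) + origin_pt J))
      = ?s * ?D * (a i * (?S + origin_pt J) - a i * point (\<sigma> ! i) J)"
      unfolding scalar_part_join_list_face[OF i a] sum_list_face[OF i] s
      by (simp add: algebra_simps)
  qed simp
  also have "\<dots> = ?s * ?D * ((\<Sum>i<length \<sigma>. a i) * (?S + origin_pt J) - origin_pt J)"
    by (simp add: o sum_distrib_right sum_subtractf flip: sum_distrib_left)
  finally show ?thesis by (simp add: a(1))
qed

section \<open>Centroid and volume of a simplex\<close>

lemma has_integral_one_compact:
  fixes T :: "'a::euclidean_space set"
  assumes "compact T"
  shows "((\<lambda>x. 1 :: real) has_integral measure lebesgue T) T"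
  using lmeasurable_compact[OF assms] lmeasure_integral lmeasurable_iff_integrable_on
  by (metis has_integral_integral)

text \<open>The values 2 and 1 are those for which \<open>x - (l (x - b) - 1) (a - b)\<close>
  exchanges \<open>a\<close> and \<open>b\<close> and fixes the other vertices. They can be
  prescribed since the edges from \<open>b\<close> are linearly independent.\<close>

lemma reflection_swapping_vertices:
  fixes S :: "'a::euclidean_space set"
  assumes ind: "\<not> affine_dependent S" and ab: "a \<in> S" "b \<in> S" "a \<noteq> b"
  obtains l :: "'a \<Rightarrow> real" where "linear l" "l (a - b) = 2" "\<And>v. v \<in> S - {a, b} \<Longrightarrow> l (v - b) = 1"
proof -
  let ?B = "(\<lambda>x. - b + x) ` (S - {b})" and ?f = "\<lambda>x. if x = a - b then 2 else 1 :: real"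
  have "independent ?B"
    using ind affine_dependent_iff_dependent2[OF ab(2)] by blast
  then have "\<exists>l. linear l \<and> (\<forall>x\<in>?B. l x = ?f x)"
    by (rule linear_independent_extend)
  then obtain l where l: "linear l" "\<forall>x\<in>?B. l x = ?f x"
    by blast
  have mem: "v - b \<in> ?B" if "v \<in> S" "v \<noteq> b" for v
    using that by (intro image_eqI[of _ _ v]) auto
  have "l (a - b) = 2" using bspec[OF l(2) mem[OF ab(1,3)]] by simp
  moreover have "l (v - b) = 1" if "v \<in> S - {a, b}" for v
    using bspec[OF l(2) mem[of v]] that by auto
  ultimately show thesis using that l(1) by blast
qed

text \<open>Invariance under exchanging any two vertices forces the barycentric coordinates of the
  normalized first moment to agree, so each is \<open>1 / Suc CARD('m)\<close>.\<close>

lemma has_integral_ident_convex_hull: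
  fixes S :: "(real^'m::{finite,wellorder}) set"
  assumes ind: "\<not> affine_dependent S" and card: "card S = Suc CARD('m)"
  shows "((\<lambda>x. x) has_integral (measure lebesgue (convex hull S) / Suc CARD('m)) *\<^sub>R \<Sum>S) (convex hull S)"
proof -
  let ?C = "convex hull S" and ?M = "measure lebesgue (convex hull S)"
  have fin: "finite S" using card card.infinite by fastforce
  have compact: "compact ?C" using fin by (rule finite_imp_compact_convex_hull)
  then have meas: "?C \<in> lmeasurable" by (rule lmeasurable_compact)
  have ai: "(\<lambda>x. x) absolutely_integrable_on ?C"
  proof -
    obtain u where "?C \<subseteq> cbox (- u) u"
      using bounded_subset_cbox_symmetric compact compact_imp_bounded by metis
    then show ?thesis
      using meas by (intro set_integrable_subset[OF absolutely_integrable_continuous])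
        (auto intro: continuous_intros dest: fmeasurableD)
  qed
  define m where "m = integral ?C (\<lambda>x. x)"
  have m: "((\<lambda>x. x) has_integral m) ?C"
    using ai unfolding m_def by (simp add: absolutely_integrable_on_def integrable_integral)
  have one: "((\<lambda>x. 1 :: real) has_integral ?M) ?C"
    using compact by (rule has_integral_one_compact)
  \<comment> \<open>The affine reflection exchanging a and b and fixing the other vertices preserves the simplex,
    hence also its first moment.\<close>
  have reflect: "l m = ?M * (l b + 1)"
    if l: "linear l" "l (a - b) = 2" "\<And>v. v \<in> S - {a, b} \<Longrightarrow> l (v - b) = 1"
      and ab: "a \<in> S" "b \<in> S" "a \<noteq> b" for l :: "real^'m::_ \<Rightarrow> real" and a b
  proof -
    interpret l: linear l by (rule l(1))
    define d where "d = a - b"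
    have ld: "l d = 2" using l(2) by (simp add: d_def)
    have d: "d \<noteq> 0" using ab(3) by (simp add: d_def)
    \<comment> \<open>\<open>L\<close> is the linear reflection that reverses \<open>d\<close>, as
      \<open>l d = 2\<close>. The shift in \<open>T\<close> places the mirror at
      \<open>l x = l b + 1\<close>, the hyperplane through the midpoint of \<open>a\<close> and
      \<open>b\<close> and all other vertices.\<close>
    define L where "L x = x - l x *\<^sub>R d" for x
    define T where "T x = L x + (l b + 1) *\<^sub>R d" for x
    have lin: "linear L"
      by (rule linearI) (simp_all add: L_def l.add l.scale algebra_simps)
    have lL: "l (L x) = - l x" for x
      by (simp add: L_def l.diff l.scale ld)
    have LL: "L (L x) = x" for x
      by (simp add: L_def[of "L x"] lL) (simp add: L_def)
    have lT: "l (T x) = - l x + 2 * (l b + 1)" for x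
      by (simp add: T_def l.add l.scale ld lL)
    have T_eq: "T x = x + (l b + 1 - l x) *\<^sub>R d" for x
      by (simp add: T_def L_def scaleR_left_diff_distrib)
    have TT: "T (T x) = x" for x
    proof -
      have "T (T x) = x + ((l b + 1 - l x) + (l b + 1 - l (T x))) *\<^sub>R d"
        unfolding scaleR_left_distrib T_eq[of "T x"] by (simp add: T_eq[of x])
      then show ?thesis by (simp add: lT)
    qed
    have "L \<circ> L = id" using LL by auto
    \<comment> \<open>An involution has determinant 1 or -1, so \<open>T\<close> preserves
      volume.\<close>
    then have "matrix L ** matrix L = mat 1"
      using matrix_compose[OF lin lin] by (simp add: matrix_id_mat_1)
    then have "det (matrix L) * det (matrix L) = 1"
      by (metis det_I det_mul)
    then have det: "\<bar>det (matrix L)\<bar> = 1"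
      by (auto simp: square_eq_1_iff)
    have Tv: "T v = v - (l (v - b) - 1) *\<^sub>R d" for v
      by (simp add: T_def L_def l.diff algebra_simps)
    have "T v \<in> S" if "v \<in> S" for v
    proof -
      consider "v = a" | "v = b" | "v \<in> S - {a, b}" using \<open>v \<in> S\<close> by blast
      then show ?thesis
      proof cases
        case 1
        then have "T v = b" using Tv[of a] l(2) by (simp add: d_def)
        then show ?thesis using ab by simp
      next
        case 2
        then have "T v = a" using Tv[of b] by (simp add: l.zero d_def)
        then show ?thesis using ab by simp
      next
        case 3
        then show ?thesis using that l(3) by (simp add: Tv)
      qed
    qed
    then have "T ` S \<subseteq> S" by blast
    moreover have "S \<subseteq> T ` S"
    proof
      fix v assume "v \<in> S"
      then have "T v \<in> S" using \<open>T ` S \<subseteq> S\<close> by blast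
      then show "v \<in> T ` S" by (metis TT imageI)
    qed
    ultimately have TS: "T ` S = S" by blast
    have T_alt: "T = (\<lambda>x. (l b + 1) *\<^sub>R d + x) \<circ> L" by (auto simp: T_def)
    have TC: "T ` ?C = ?C"
    proof -
      have "T ` ?C = (\<lambda>x. (l b + 1) *\<^sub>R d + x) ` (convex hull (L ` S))"
        unfolding T_alt image_comp[symmetric] convex_hull_linear_image[OF lin] ..
      also have "\<dots> = convex hull (T ` S)"
        unfolding T_alt image_comp[symmetric] convex_hull_translation ..
      finally show ?thesis by (simp add: TS)
    qed
    have der: "(T has_derivative L) (at x within ?C)" for x
    proof -
      have "(L has_derivative L) (at x within ?C)"
        using lin by (simp add: linear_imp_has_derivative)
      then show ?thesis
        unfolding T_def[abs_def] by (auto intro: derivative_eq_intros)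
    qed
    have "inj_on T ?C" using TT by (metis inj_on_inverseI)
    \<comment> \<open>Change of variables along \<open>T\<close>, which maps the simplex onto
      itself, shows that \<open>T\<close> and the identity have the same integral.\<close>
    then have "integral (T ` ?C) (\<lambda>x. x) = integral ?C (\<lambda>x. \<bar>det (matrix L)\<bar> *\<^sub>R T x)"
      using meas der ai TC
      by (intro integral_change_of_variables) (auto dest: fmeasurableD)
    then have "integral ?C T = m"
      by (simp add: TC det m_def)
    moreover have "(T has_integral (m - l m *\<^sub>R d) + (?M * (l b + 1)) *\<^sub>R d) ?C"
    proof -
      have "bounded_linear L" using lin by (simp add: linear_conv_bounded_linear)
      from has_integral_linear[OF m this] have 1: "(L has_integral L m) ?C" by (simp add: o_def)
      have "bounded_linear (\<lambda>t. t *\<^sub>R ((l b + 1) *\<^sub>R d))" by (rule bounded_linear_scaleR_left)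
      from has_integral_linear[OF one this]
      have 2: "((\<lambda>x. (l b + 1) *\<^sub>R d) has_integral ?M *\<^sub>R ((l b + 1) *\<^sub>R d)) ?C"
        by (simp add: o_def)
      show ?thesis using has_integral_add[OF 1 2] by (simp add: T_def[abs_def] L_def)
    qed
    ultimately have "m = (m - l m *\<^sub>R d) + (?M * (l b + 1)) *\<^sub>R d"
      by (simp add: integral_unique)
    then have "(l m - ?M * (l b + 1)) *\<^sub>R d = 0" by (simp add: algebra_simps)
    then show ?thesis using d by simp
  qed
  have "m = (?M / Suc CARD('m)) *\<^sub>R \<Sum>S"
  proof (cases "?M = 0")
    \<comment> \<open>With zero volume the barycentric argument cannot divide by \<open>?M\<close>,
      but then the moment vanishes as well.\<close>
    case True
    then have "negligible ?C"
      using meas negligible_iff_measure by blast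
    then have "m = 0" unfolding m_def by (simp add: integral_negligible)
    then show ?thesis using True by simp
  next
    case False
    have "aff_dim S = DIM(real^'m::_)"
      using aff_dim_affine_independent[OF ind] card by simp
    then have "affine hull S = UNIV" by (simp only: aff_dim_eq_full)
    then have "(1 / ?M) *\<^sub>R m \<in> affine hull S" by simp
    then obtain c where c: "sum c S = 1" "(\<Sum>v\<in>S. c v *\<^sub>R v) = (1 / ?M) *\<^sub>R m"
      unfolding affine_hull_finite[OF fin] by auto
    have eq: "c a = c b" if ab: "a \<in> S" "b \<in> S" for a b
    proof (cases "a = b")
      case False
      obtain l :: "real^'m::_ \<Rightarrow> real" where l: "linear l" "l (a - b) = 2"
        "\<And>v. v \<in> S - {a, b} \<Longrightarrow> l (v - b) = 1"
        using reflection_swapping_vertices[OF ind ab False] by blast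
      interpret l: linear l by (rule l(1))
      have "l ((1 / ?M) *\<^sub>R m) = l b + 1"
        using reflect[OF l ab False] \<open>?M \<noteq> 0\<close> by (simp add: l.scale)
      moreover have "l ((1 / ?M) *\<^sub>R m) = (\<Sum>v\<in>S. c v * l v)"
        unfolding c(2)[symmetric] by (simp add: l.sum l.scale)
      \<comment> \<open>\<open>l\<close> takes the value \<open>l b + 1\<close> at all vertices but
        \<open>a\<close>, where it is one more, and \<open>b\<close>, where it is one less.\<close>
      moreover have "(\<Sum>v\<in>S. c v * l v) = (\<Sum>v\<in>S. c v * (l b + 1) + (if v = a then c v else 0) - (if v = b then c v else 0))"
      proof (rule sum.cong)
        fix v assume "v \<in> S"
        then show "c v * l v = c v * (l b + 1) + (if v = a then c v else 0) - (if v = b then c v else 0)"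
          using l(2) l(3)[of v] False by (auto simp: l.diff algebra_simps)
      qed simp
      moreover have "\<dots> = (l b + 1) + c a - c b"
        using ab fin c(1) by (simp add: sum.distrib sum_subtractf flip: sum_distrib_right)
      ultimately show ?thesis by simp
    qed simp
    have c_eq: "c a = 1 / Suc CARD('m)" if "a \<in> S" for a
    proof -
      have "sum c S = (\<Sum>v\<in>S. c a)" by (rule sum.cong[OF refl]) (rule eq[OF _ that])
      then have "c a * Suc CARD('m) = 1" using c(1) card by (simp add: algebra_simps)
      then show ?thesis by (simp add: eq_divide_eq del: of_nat_Suc)
    qed
    have "(1 / ?M) *\<^sub>R m = (\<Sum>v\<in>S. (1 / Suc CARD('m)) *\<^sub>R v)"
      unfolding c(2)[symmetric] by (rule sum.cong[OF refl]) (simp only: c_eq)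
    also have "\<dots> = (1 / Suc CARD('m)) *\<^sub>R \<Sum>S" by (simp add: scaleR_sum_right)
    finally have "?M *\<^sub>R ((1 / ?M) *\<^sub>R m) = ?M *\<^sub>R ((1 / Suc CARD('m)) *\<^sub>R \<Sum>S)" by simp
    then show ?thesis using False by simp
  qed
  then show ?thesis using m by simp
qed

section \<open>Renaming coordinates along a bijection of index types\<close>

lemma image_cbox_reindex:
  fixes p :: "'m::finite \<Rightarrow> 'n::finite"
  assumes p: "bij p"
  shows "(\<lambda>x::real^'n. \<chi> i. x $ p i) ` cbox u v = cbox (\<chi> i. u $ p i) (\<chi> i. v $ p i)"
proof
  show "(\<lambda>x::real^'n. \<chi> i. x $ p i) ` cbox u v \<subseteq> cbox (\<chi> i. u $ p i) (\<chi> i. v $ p i)"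
    by (auto simp: mem_box_cart)
  show "cbox (\<chi> i. u $ p i) (\<chi> i. v $ p i) \<subseteq> (\<lambda>x::real^'n. \<chi> i. x $ p i) ` cbox u v"
  proof
    fix y :: "real^'m" assume y: "y \<in> cbox (\<chi> i. u $ p i) (\<chi> i. v $ p i)"
    let ?x = "\<chi> j. y $ inv p j"
    have "u $ j \<le> ?x $ j \<and> ?x $ j \<le> v $ j" for j
      using y[unfolded mem_box_cart, rule_format, of "inv p j"] p
      by (simp add: bij_is_surj surj_f_inv_f)
    then have "?x \<in> cbox u v" by (simp add: mem_box_cart)
    moreover have "y = (\<chi> i. ?x $ p i)" using p by (simp add: vec_eq_iff bij_is_inj)
    ultimately show "y \<in> (\<lambda>x::real^'n. \<chi> i. x $ p i) ` cbox u v" by blast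
  qed
qed

lemma content_cbox_reindex:
  fixes p :: "'m::finite \<Rightarrow> 'n::finite"
  assumes p: "bij p"
  shows "measure lborel (cbox (\<chi> i. u $ p i) (\<chi> i. v $ p i) :: (real^'m) set) = measure lborel (cbox u v :: (real^'n) set)"
proof -
  have "(\<Prod>i\<in>UNIV. v $ p i - u $ p i) = (\<Prod>j\<in>UNIV. v $ j - u $ j)"
    using prod.reindex_bij_betw[OF p, of "\<lambda>j. v $ j - u $ j"] .
  moreover have "cbox (\<chi> i. u $ p i) (\<chi> i. v $ p i) = {} \<longleftrightarrow> cbox u v = {}"
    unfolding image_cbox_reindex[OF p, symmetric] by simp
  ultimately show ?thesis by (simp add: content_cbox_if_cart)
qed

text \<open>Renaming coordinates carries boxes to boxes of equal content in both directions.
  Boundedness of \<open>S\<close> puts the integral on one such box, with the integrand extended by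
  zero.\<close>

lemma has_integral_reindex:
  fixes p :: "'m::finite \<Rightarrow> 'n::finite" and f :: "real^'m \<Rightarrow> 'b::banach"
  assumes p: "bij p" and f: "(f has_integral y) S" and S: "bounded S"
  shows "((\<lambda>x::real^'n. f (\<chi> i. x $ p i)) has_integral y) ((\<lambda>x. \<chi> i. x $ p i) -` S)"
proof -
  let ?g = "\<lambda>x::real^'n. \<chi> i. x $ p i" and ?h = "\<lambda>x::real^'m. \<chi> j. x $ inv p j"
  obtain u where u: "S \<subseteq> cbox (- u) u" using bounded_subset_cbox_symmetric[OF S] .
  have q: "bij (inv p)" using p by (rule bij_imp_bij_inv)
  have hg: "?h (?g x) = x" for x using p by (simp add: vec_eq_iff bij_is_surj surj_f_inv_f)
  have gh: "?g (?h x) = x" for x using p by (simp add: vec_eq_iff bij_is_inj)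
  have "linear ?g" by (rule linearI) (simp_all add: vec_eq_iff)
  then have contg: "continuous (at x) ?g" for x
    by (simp add: linear_continuous_at linear_conv_bounded_linear)
  have "((\<lambda>x. if x \<in> S then f x else 0) has_integral y) (cbox (- u) u)"
    using f u by (simp add: has_integral_restrict)
  then have "((\<lambda>x. if ?g x \<in> S then f (?g x) else 0) has_integral (1 / 1) *\<^sub>R y) (?h ` cbox (- u) u)"
    by (rule has_integral_twiddle[where g = ?g and h = ?h and r = 1, rotated -1])
      (use hg gh contg image_cbox_reindex[OF p] image_cbox_reindex[OF q] content_cbox_reindex[OF p] in
       \<open>auto\<close>)
  then have "((\<lambda>x. if x \<in> ?g -` S then f (?g x) else 0) has_integral y) (?h ` cbox (- u) u)"
    by simp
  moreover have "?g -` S \<subseteq> ?h ` cbox (- u) u"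
  proof
    fix x assume "x \<in> ?g -` S"
    then have "?g x \<in> cbox (- u) u" using u by auto
    then show "x \<in> ?h ` cbox (- u) u" using hg[of x] by (metis imageI)
  qed
  ultimately show ?thesis by (simp only: has_integral_restrict)
qed

text \<open>Change of variables in the library needs a wellorder on the index type, which a finite linear
  order has but not as a class instance; hence this copy of the index type.\<close>

typedef 'n wo_index = "UNIV :: 'n set" by simp

lemma bij_Rep_wo_index: "bij Rep_wo_index"
  by (metis (no_types, lifting) Rep_wo_index_inject Abs_wo_index_inverse UNIV_I bijI injI surjI)

instance wo_index :: (finite) finite
proof
  show "finite (UNIV :: 'a wo_index set)"
    using bij_Rep_wo_index finite_imageD[of Rep_wo_index UNIV]
    by (metis bij_is_inj finite)
qed

lemma card_wo_index: "CARD('n wo_index) = CARD('n)"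
  using bij_betw_same_card[OF bij_Rep_wo_index] .

instantiation wo_index :: (linorder) linorder
begin
definition less_eq_wo_index :: "'a wo_index \<Rightarrow> 'a wo_index \<Rightarrow> bool" where
  "x \<le> y \<longleftrightarrow> Rep_wo_index x \<le> Rep_wo_index y"
definition less_wo_index :: "'a wo_index \<Rightarrow> 'a wo_index \<Rightarrow> bool" where
  "x < y \<longleftrightarrow> Rep_wo_index x < Rep_wo_index y"
instance
  by standard (auto simp: less_eq_wo_index_def less_wo_index_def less_le_not_le simp flip: Rep_wo_index_inject)
end

instance wo_index :: ("{finite,linorder}") wellorder
proof
  fix P :: "'a wo_index \<Rightarrow> bool" and a
  assume step: "\<And>x. (\<And>y. y < x \<Longrightarrow> P y) \<Longrightarrow> P x"
  show "P a"
  proof (induction a rule: measure_induct_rule[where f = "\<lambda>x. card {y. y < x}"])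
    case (less x)
    have "card {z. z < y} < card {z. z < x}" if "y < x" for y
      using that by (intro psubset_card_mono) auto
    then show ?case using less step by blast
  qed
qed

text \<open>So few points lie in a proper affine subspace, whence their hull has empty interior.
  This serves for the overlaps of simplices.\<close>

lemma negligible_convex_hull:
  fixes T :: "'a::euclidean_space set"
  assumes "finite T" "card T \<le> DIM('a)"
  shows "negligible (convex hull T)"
proof -
  have "aff_dim (convex hull T) \<noteq> DIM('a)"
    using aff_dim_le_card[OF assms(1)] assms(2) by (simp add: aff_dim_convex_hull)
  then have "interior (convex hull T) = {}"
    using aff_dim_nonempty_interior by blast
  then show ?thesis by (simp add: negligible_convex_interior)
qed

definition wo_vec :: "real^'n \<Rightarrow> real^'n wo_index" where
  "wo_vec x = (\<chi> i. x $ Rep_wo_index i)"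

lemma linear_wo_vec: "linear wo_vec"
  by (rule linearI) (simp_all add: wo_vec_def vec_eq_iff)

lemma inj_wo_vec: "inj wo_vec"
proof (rule injI)
  fix x y :: "real^'n" assume eq: "wo_vec x = wo_vec y"
  have "x $ j = y $ j" for j
    using arg_cong[OF eq, of "\<lambda>z. z $ Abs_wo_index j"] by (simp add: wo_vec_def Abs_wo_index_inverse)
  then show "x = y" by (simp add: vec_eq_iff)
qed

section \<open>Centroid and volume of one simplex over a finite linearly ordered index type\<close>

context
  fixes S :: "(real^'n::{finite,linorder}) set"
  assumes ind: "\<not> affine_dependent S" and card: "card S = Suc CARD('n)"
begin

lemma finite_simplex: "finite S"
  using card card.infinite by fastforce

lemma inj_on_wo_vec: "inj_on wo_vec S"
  using inj_wo_vec by (rule inj_on_subset) simp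

lemma compact_simplex: "compact (convex hull S)"
  using finite_simplex by (rule finite_imp_compact_convex_hull)

lemma has_integral_wo_vec:
  fixes f :: "real^'n wo_index \<Rightarrow> 'b::banach"
  assumes "(f has_integral y) (convex hull (wo_vec ` S))"
  shows "((\<lambda>x. f (wo_vec x)) has_integral y) (convex hull S)"
proof -
  have "bounded (convex hull (wo_vec ` S))"
    using finite_simplex by (simp add: finite_imp_bounded_convex_hull)
  from has_integral_reindex[OF bij_Rep_wo_index assms this, folded wo_vec_def]
  have "((\<lambda>x. f (wo_vec x)) has_integral y) (wo_vec -` (convex hull (wo_vec ` S)))" .
  moreover have "wo_vec -` (convex hull (wo_vec ` S)) = convex hull S"
    unfolding convex_hull_linear_image[OF linear_wo_vec, symmetric]
    by (rule inj_vimage_image_eq[OF inj_wo_vec])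
  ultimately show ?thesis by simp
qed

lemma wo_vec_simplex:
  "\<not> affine_dependent (wo_vec ` S)" "card (wo_vec ` S) = Suc CARD('n wo_index)"
proof -
  show c: "card (wo_vec ` S) = Suc CARD('n wo_index)"
    using card card_image[OF inj_on_wo_vec] by (simp add: card_wo_index)
  show "\<not> affine_dependent (wo_vec ` S)"
    using ind finite_simplex card c
    by (simp add: affine_independent_iff_card aff_dim_injective_linear_image[OF linear_wo_vec inj_wo_vec] card_wo_index)
qed

lemma measure_wo_vec:
  "measure lebesgue (convex hull (wo_vec ` S)) = measure lebesgue (convex hull S)"
proof -
  have "compact (convex hull (wo_vec ` S))"
    using finite_simplex by (simp add: finite_imp_compact_convex_hull)
  from has_integral_wo_vec[OF has_integral_one_compact[OF this]] show ?thesis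
    using has_integral_one_compact[OF compact_simplex] has_integral_unique by blast
qed

lemma has_integral_ident_simplex:
  "((\<lambda>x. x) has_integral (measure lebesgue (convex hull S) / Suc CARD('n)) *\<^sub>R \<Sum>S) (convex hull S)"
proof -
  \<comment> \<open>\<open>has_integral_wo_vec\<close> renames only the argument; composing with the
    inverse renaming \<open>?g\<close> brings the values back as well.\<close>
  let ?g = "\<lambda>y::real^'n wo_index. \<chi> j. y $ Abs_wo_index j"
  have g: "?g (wo_vec x) = x" for x
    by (simp add: wo_vec_def vec_eq_iff Abs_wo_index_inverse)
  have "linear ?g" by (rule linearI) (simp_all add: vec_eq_iff)
  then have bl: "bounded_linear ?g" by (simp add: linear_conv_bounded_linear)
  have "\<Sum>(wo_vec ` S) = wo_vec (\<Sum>S)"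
    by (simp add: sum.reindex[OF inj_on_wo_vec] linear_sum[OF linear_wo_vec])
  then have "(measure lebesgue (convex hull S) / Suc CARD('n)) *\<^sub>R \<Sum>(wo_vec ` S)
      = wo_vec ((measure lebesgue (convex hull S) / Suc CARD('n)) *\<^sub>R \<Sum>S)"
    by (simp only: linear_cmul[OF linear_wo_vec])
  then have "(wo_vec has_integral wo_vec ((measure lebesgue (convex hull S) / Suc CARD('n)) *\<^sub>R \<Sum>S)) (convex hull S)"
    using has_integral_wo_vec[OF has_integral_ident_convex_hull[OF wo_vec_simplex]]
    by (simp only: measure_wo_vec card_wo_index)
  from has_integral_linear[OF this bl] show ?thesis by (simp add: o_def g)
qed

lemma has_integral_affine_simplex:
  assumes "\<exists>c w. \<forall>x. f x = c + w \<bullet> x"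
  shows "(f has_integral measure lebesgue (convex hull S) / Suc CARD('n) * (\<Sum>v\<in>S. f v)) (convex hull S)"
proof -
  let ?M = "measure lebesgue (convex hull S)"
  obtain c w where f: "\<And>x. f x = c + w \<bullet> x" using assms by blast
  from has_integral_mult_right[OF has_integral_one_compact[OF compact_simplex], of c]
  have "((\<lambda>x. c) has_integral c * ?M) (convex hull S)" by simp
  moreover have "((\<lambda>x. w \<bullet> x) has_integral w \<bullet> ((?M / Suc CARD('n)) *\<^sub>R \<Sum>S)) (convex hull S)"
    using has_integral_linear[OF has_integral_ident_simplex bounded_linear_inner_right] by (simp add: o_def)
  ultimately have "((\<lambda>x. c + w \<bullet> x) has_integral c * ?M + w \<bullet> ((?M / Suc CARD('n)) *\<^sub>R \<Sum>S)) (convex hull S)"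
    by (rule has_integral_add)
  moreover have "c * ?M + w \<bullet> ((?M / Suc CARD('n)) *\<^sub>R \<Sum>S) = ?M / Suc CARD('n) * (\<Sum>v\<in>S. f v)"
    by (simp add: f sum.distrib card inner_sum_right distrib_left del: of_nat_Suc)
  ultimately show ?thesis by (simp add: f[abs_def])
qed

text \<open>This is the edge determinant formula for the volume. Indexing the other vertices by
  \<open>'n wo_index\<close> makes the edge matrix square; edges are rows here, to match the factors
  of a \<open>wedge\<close>.\<close>

lemma measure_simplex:
  fixes f :: "'n wo_index \<Rightarrow> real^'n::_"
  assumes x0: "x0 \<in> S" and bij: "bij_betw f UNIV (S - {x0})"
  shows "measure lebesgue (convex hull S)
    = \<bar>det (\<chi> i j. f i $ Rep_wo_index j - x0 $ Rep_wo_index j)\<bar> / fact CARD('n)"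
proof -
  have "bij_betw (wo_vec \<circ> f) UNIV (wo_vec ` S - {wo_vec x0})"
  proof (rule bij_betw_trans[OF bij])
    show "bij_betw wo_vec (S - {x0}) (wo_vec ` S - {wo_vec x0})"
      unfolding bij_betw_def using inj_wo_vec x0 by (auto simp: inj_on_def)
  qed
  then have "measure lborel (convex hull (wo_vec ` S))
      = \<bar>det (\<chi> i j. (wo_vec \<circ> f) j $ i - wo_vec x0 $ i)\<bar> / fact CARD('n wo_index)"
    using content_simplex[of "wo_vec ` S" "wo_vec x0" "wo_vec \<circ> f"] x0 finite_simplex wo_vec_simplex
    by simp
  moreover have "(\<chi> i j. (wo_vec \<circ> f) j $ i - wo_vec x0 $ i)
     = transpose (\<chi> i j. f i $ Rep_wo_index j - x0 $ Rep_wo_index j)"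
    by (simp add: transpose_def wo_vec_def vec_eq_iff)
  moreover have "compact (convex hull (wo_vec ` S))"
    using finite_simplex by (simp add: finite_imp_compact_convex_hull)
  then have "measure lebesgue (convex hull (wo_vec ` S)) = measure lborel (convex hull (wo_vec ` S))"
    by (intro measure_completion) (auto dest: compact_imp_closed)
  ultimately show ?thesis
    by (simp add: measure_wo_vec card_wo_index)
qed

end

text \<open>Subtracting the first vertex from the others leaves it as the only factor with an
  \<open>e_0\<close> component; stripping that component off reduces the join to the determinant of
  the edges.\<close>

lemma abs_scalar_part_join_list:
  fixes \<sigma> :: "(real^'n::{finite,linorder}) list"
  assumes "top_simplex \<sigma>"
  shows "\<bar>scalar_part (join_list (map point \<sigma>))\<bar> = fact CARD('n) * measure lebesgue (convex hull (set \<sigma>))"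
proof -
  have len: "length \<sigma> = Suc CARD('n)" and dist: "distinct \<sigma>" and ind: "\<not> affine_dependent (set \<sigma>)"
    using assms by (simp_all add: top_simplex_def)
  obtain x0 ws where \<sigma>: "\<sigma> = x0 # ws" using len by (cases \<sigma>) auto
  have ws: "x0 \<notin> set ws" "distinct ws" "length ws = CARD('n)" using len dist \<sigma> by auto
  have "card (set ws) = CARD('n wo_index)"
    using ws by (simp add: distinct_card card_wo_index)
  then obtain f :: "'n wo_index \<Rightarrow> real^'n::_" where f: "bij_betw f UNIV (set ws)"
    using finite_same_card_bij[of "UNIV :: 'n wo_index set" "set ws"] by auto
  define g where "g = inv_into UNIV f"
  have fg: "f (g w) = w" if "w \<in> set ws" for w
    unfolding g_def using f that by (simp add: bij_betw_inv_into_right)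
  have g: "bij_betw g (set ws) UNIV" unfolding g_def by (rule bij_betw_inv_into[OF f])
  let ?es = "map g (rev ws)" and ?p = "\<lambda>a. Abs_wo_index (the a)"
  let ?A = "\<chi> i j. f i $ Rep_wo_index j - x0 $ Rep_wo_index j"
  define h :: "real^'n::_ \<Rightarrow> 'n option \<Rightarrow> real" where "h x j = e0_plus x {j}" for x j
  have h: "h x None = 1" "h x (Some i) = x $ i" for x i
    by (simp_all add: h_def e0_plus_def)
  have hom: "homogeneous = (\<lambda>(x::real^'n::_) j. (-1) ^ CARD('n) * h x j)"
    by (simp add: homogeneous_def hodge_point h_def fun_eq_iff)
  have ne: "\<sigma> \<noteq> []" by (simp add: \<sigma>)
  have "\<bar>scalar_part (join_list (map point \<sigma>))\<bar> = \<bar>wedge (map (\<lambda>x j. (-1) ^ CARD('n) * h x j) (rev \<sigma>)) UNIV\<bar>"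
    by (simp only: scalar_part_join_list[OF ne] rev_map hom)
  \<comment> \<open>The sign factors contained in \<open>homogeneous\<close> disappear under the
    absolute value.\<close>
  also have "\<dots> = \<bar>wedge (map h (rev \<sigma>)) UNIV\<bar>"
    unfolding wedge_scale_map by (simp add: map_replicate_const abs_mult power_abs)
  also have "wedge (map h (rev \<sigma>)) UNIV = wedge (map h (rev ws) @ [h x0]) UNIV"
    by (simp add: \<sigma>)
  also have "\<dots> = wedge (map (\<lambda>v j. v j - h x0 j) (map h (rev ws)) @ [h x0]) UNIV"
    by (rule wedge_diff_last[of "[]", simplified, symmetric])
  also have "UNIV = insert None (range Some :: 'n option set)"
    by (simp add: UNIV_option_conv)
  also have "wedge (map (\<lambda>v j. v j - h x0 j) (map h (rev ws)) @ [h x0]) (insert None (range Some))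
      = wedge (map (\<lambda>v j. v j - h x0 j) (map h (rev ws))) (range Some)"
    by (subst wedge_insert_least) (auto simp: h ws card_image)
  also have "map (\<lambda>v j. v j - h x0 j) (map h (rev ws)) = map (\<lambda>w j. h w j - h x0 j) (rev ws)"
    by simp
  also have "wedge \<dots> (range Some) = wedge (map (\<lambda>w a. ?A $ g w $ ?p a) (rev ws)) (range Some)"
    by (rule wedge_map_cong) (auto simp: h fg Abs_wo_index_inverse)
  also have "map (\<lambda>w a. ?A $ g w $ ?p a) (rev ws) = map (\<lambda>i a. ?A $ i $ ?p a) ?es"
    by simp
  also have "\<bar>wedge \<dots> (range Some)\<bar> = \<bar>det ?A\<bar>"
  proof (rule abs_wedge_eq_abs_det)
    show "distinct ?es" "set ?es = UNIV"
      using g ws by (auto simp: bij_betw_def distinct_map)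
    have "inj Abs_wo_index" by (metis Abs_wo_index_inverse UNIV_I injI)
    moreover have "surj Abs_wo_index" by (metis Rep_wo_index_inverse surjI)
    ultimately have "bij_betw Abs_wo_index (UNIV :: 'n set) UNIV" by (simp add: bij_def)
    moreover have "bij_betw the (range Some) (UNIV :: 'n set)"
      by (auto simp: bij_betw_def inj_on_def image_comp)
    ultimately show "bij_betw ?p (range Some :: 'n option set) UNIV"
      using bij_betw_trans[of the "range Some" UNIV Abs_wo_index UNIV] by (simp add: o_def)
  qed simp
  also have "\<bar>det ?A\<bar> = fact CARD('n) * measure lebesgue (convex hull (set \<sigma>))"
  proof -
    have "card (set \<sigma>) = Suc CARD('n)" using len dist by (simp add: distinct_card)
    moreover have "set \<sigma> - {x0} = set ws" using \<sigma> ws by auto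
    ultimately show ?thesis
      using measure_simplex[OF ind _ _ f[folded \<open>set \<sigma> - {x0} = set ws\<close>]] \<sigma> by simp
  qed
  finally show ?thesis .
qed

text \<open>The k + 1 affinely independent vertices span the whole space. The weights are indexed by
  list position to match \<open>face i \<sigma>\<close>.\<close>

lemma barycentric_coordinates:
  fixes \<sigma> :: "(real^'n::{finite,linorder}) list"
  assumes "top_simplex \<sigma>"
  obtains a where "(\<Sum>l<length \<sigma>. a l) = (1::real)" "(\<Sum>l<length \<sigma>. a l *\<^sub>R \<sigma> ! l) = x"
proof -
  have len: "length \<sigma> = Suc CARD('n)" and dist: "distinct \<sigma>" and ind: "\<not> affine_dependent (set \<sigma>)"
    using assms by (simp_all add: top_simplex_def)
  have "aff_dim (set \<sigma>) = DIM(real^'n::_)"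
    using aff_dim_affine_independent[OF ind] len dist by (simp add: distinct_card)
  then have "affine hull (set \<sigma>) = UNIV" by (simp only: aff_dim_eq_full)
  then have "x \<in> affine hull (set \<sigma>)" by simp
  then obtain c where c: "sum c (set \<sigma>) = 1" "(\<Sum>v\<in>set \<sigma>. c v *\<^sub>R v) = x"
    unfolding affine_hull_finite[OF finite_set] by auto
  have b: "bij_betw ((!) \<sigma>) {..<length \<sigma>} (set \<sigma>)" using dist by (simp add: bij_betw_nth)
  show thesis
    using that[of "\<lambda>l. c (\<sigma> ! l)"] c
      sum.reindex_bij_betw[OF b, of c] sum.reindex_bij_betw[OF b, of "\<lambda>v. c v *\<^sub>R v"] by simp
qed

section \<open>Complexes\<close>

text \<open>The sign assumption fixes the orientation of each listed simplex: the factor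
  \<open>(-1)^k D\<close> produced by \<open>boundary_moment\<close> is then k! times the volume and
  not its negative. The simplices can therefore be treated one by one and their moments
  added.\<close>

theorem theorem3:
  fixes K :: "(real^'n::{finite,linorder}) list list"
  assumes "simplicial_complex K"
    and "\<forall>\<sigma>\<in>set K. (-1) ^ CARD('n) * scalar_part (join_list (map point \<sigma>)) > 0"
  shows "center_of_mass (carrier K) =
    mv_scale (1 / (measure lebesgue (carrier K) * fact (CARD('n) + 1)))
      (boundary_sum
         (\<lambda>vs. mv_scale (scalar_part (join_list (map point vs @ [origin_pt])))
                  (mv_add (mv_sum_list (map point vs)) origin_pt))
         K)"
proof
  fix J :: "'n option set"
  define F :: "(real^'n::_) list \<Rightarrow> 'n mv" where
    "F = (\<lambda>vs. mv_scale (scalar_part (join_list (map point vs @ [origin_pt])))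
                  (mv_add (mv_sum_list (map point vs)) origin_pt))"
  define b where "b \<sigma> = (\<Sum>i\<leftarrow>[0..<length \<sigma>]. (-1) ^ i * F (face i \<sigma>) J)" for \<sigma>
  have top: "top_simplex \<sigma>" if "\<sigma> \<in> set K" for \<sigma>
    using assms(1) that by (simp add: simplicial_complex_def)
  have card: "card (set \<sigma>) = Suc CARD('n)" if "\<sigma> \<in> set K" for \<sigma>
    using top[OF that] by (simp add: top_simplex_def distinct_card)
  have int: "((\<lambda>x. point x J) has_integral b \<sigma> / fact (CARD('n) + 1)) (convex hull (set \<sigma>))"
    if \<sigma>: "\<sigma> \<in> set K" for \<sigma>
  proof -
    let ?D = "scalar_part (join_list (map point \<sigma>))"
    have len: "length \<sigma> = CARD('n) + 1" and dist: "distinct \<sigma>" and ind: "\<not> affine_dependent (set \<sigma>)"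
      using top[OF \<sigma>] by (simp_all add: top_simplex_def)
    obtain a where a: "(\<Sum>l<length \<sigma>. a l) = (1::real)" "(\<Sum>l<length \<sigma>. a l *\<^sub>R \<sigma> ! l) = 0"
      using barycentric_coordinates[OF top[OF \<sigma>]] .
    have S: "(\<Sum>v\<leftarrow>\<sigma>. point v J) = (\<Sum>v\<in>set \<sigma>. point v J)"
      using sum.distinct_set_conv_list[OF dist] by metis
    have "(-1) ^ CARD('n) * ?D = \<bar>(-1) ^ CARD('n) * ?D\<bar>"
      using assms(2) \<sigma> by (simp add: less_imp_le)
    also have "\<dots> = fact CARD('n) * measure lebesgue (convex hull (set \<sigma>))"
      by (simp add: abs_mult power_abs abs_scalar_part_join_list[OF top[OF \<sigma>]])
    finally have D: "(-1) ^ CARD('n) * ?D = fact CARD('n) * measure lebesgue (convex hull (set \<sigma>))" .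
    have "b \<sigma> = fact CARD('n) * measure lebesgue (convex hull (set \<sigma>)) * (\<Sum>v\<in>set \<sigma>. point v J)"
      using boundary_moment[OF len a, of J]
      by (simp add: b_def F_def mv_scale_def mv_add_def mv_sum_list_apply o_def S D)
    \<comment> \<open>The k! of the signed volume and the k + 1 of the centroid make up the (k + 1)!
      of the formula.\<close>
    moreover have "fact (CARD('n) + 1) = real (Suc CARD('n)) * fact CARD('n)" by simp
    ultimately have "b \<sigma> / fact (CARD('n) + 1)
      = measure lebesgue (convex hull (set \<sigma>)) / Suc CARD('n) * (\<Sum>v\<in>set \<sigma>. point v J)"
      by (simp only:) (simp del: of_nat_Suc)
    then show ?thesis
      using has_integral_affine_simplex[OF ind card[OF \<sigma>] point_affine, of J] by simp
  qed
  \<comment> \<open>The union is indexed by positions in \<open>K\<close>, as the intersection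
    condition of a complex is.\<close>
  have "((\<lambda>x. point x J) has_integral (\<Sum>i\<in>{..<length K}. b (K ! i) / fact (CARD('n) + 1)))
      (\<Union>i\<in>{..<length K}. convex hull (set (K ! i)))"
  proof (rule has_integral_UN)
    show "pairwise (\<lambda>i j. negligible (convex hull (set (K ! i)) \<inter> convex hull (set (K ! j)))) {..<length K}"
    proof (rule pairwiseI)
      fix i j assume ij: "i \<in> {..<length K}" "j \<in> {..<length K}" "i \<noteq> j"
      then have ne: "set (K ! i) \<noteq> set (K ! j)"
        and eq: "convex hull (set (K ! i)) \<inter> convex hull (set (K ! j))
          = convex hull (set (K ! i) \<inter> set (K ! j))"
        using assms(1) by (simp_all add: simplicial_complex_def)
      have c: "card (set (K ! i)) = Suc CARD('n)" "card (set (K ! j)) = Suc CARD('n)"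
        using card ij by simp_all
      \<comment> \<open>Different vertex sets of equal size cannot contain each other, so a common
        face has at most k vertices and is negligible.\<close>
      have "\<not> set (K ! i) \<subseteq> set (K ! j)"
        using ne c by (metis List.finite_set card_subset_eq)
      then have "set (K ! i) \<inter> set (K ! j) \<subset> set (K ! i)" by blast
      then have "card (set (K ! i) \<inter> set (K ! j)) < card (set (K ! i))"
        by (intro psubset_card_mono) auto
      then show "negligible (convex hull (set (K ! i)) \<inter> convex hull (set (K ! j)))"
        unfolding eq using c by (intro negligible_convex_hull) auto
    qed
  qed (use int in auto)
  moreover have "set K = (!) K ` {..<length K}" by (auto simp: set_conv_nth)
  then have "(\<Union>i\<in>{..<length K}. convex hull (set (K ! i))) = carrier K"
    unfolding carrier_def by simp
  ultimately have "integral (carrier K) (\<lambda>x. point x J) = (\<Sum>i<length K. b (K ! i)) / fact (CARD('n) + 1)"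
    by (simp only: integral_unique sum_divide_distrib)
  moreover have "boundary_sum F K J = (\<Sum>i<length K. b (K ! i))"
    by (simp add: boundary_sum_def mv_sum_list_apply o_def mv_scale_def b_def sum_list_sum_nth atLeast0LessThan)
  ultimately show "center_of_mass (carrier K) J = mv_scale (1 / (measure lebesgue (carrier K) * fact (CARD('n) + 1)))
      (boundary_sum (\<lambda>vs. mv_scale (scalar_part (join_list (map point vs @ [origin_pt])))
                  (mv_add (mv_sum_list (map point vs)) origin_pt)) K) J"
    unfolding F_def[symmetric] by (simp only: center_of_mass_def mv_scale_def) simp
qed

end
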